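(* Let $q$ be a prime power and $s\ge 1$. If a set of $s$ mutually orthogoval Desarguesian projective planes of order $q$ exists, then there exists a $\mathrm{CPHF}_{s-1}(s;\,3,\,q^2+q+1,\,q)$. If a set of $s$ mutually orthogoval Desarguesian affine planes of order $q$ exists, then there exists an $\mathrm{SCPHF}_{s-1}(s;\,3,\,q^2,\,q)$.
   Context: Two planes, both projective or both affine, of the same order and on the same point set are orthogoval if every line of one meets every line of the other in at most two points; a set is mutually orthogoval if pairwise orthogoval. A covering perfect hash family $\mathrm{CPHF}_{\lambda}(n;t,k,q)$ is an $n\times k$ array with entries from $\mathbb{F}_q^t\setminus\{\vec 0\}$ such that for each set $T$ of $t$ columns there exist at least $\lambda$ rows whose entries in the columns of $T$ are linearly independent over $\mathbb{F}_q$; if all entries have nonzero last coordinate, it is a Sherwood covering perfect hash family $\mathrm{SCPHF}_{\lambda}(n;t,k,q)$. *)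

theory Defs
  imports "HOL-Analysis.Analysis" "HOL-Number_Theory.Prime_Powers"
begin

text \<open>A plane is a set of points together with a set of lines, each line being the set of points
  on it.\<close>

type_synonym 'p plane = "'p set \<times> 'p set set"

abbreviation points :: "'p plane \<Rightarrow> 'p set" where
  "points \<equiv> fst"

abbreviation lines :: "'p plane \<Rightarrow> 'p set set" where
  "lines \<equiv> snd"

definition projective_plane :: "nat \<Rightarrow> 'p plane \<Rightarrow> bool" where
  "projective_plane q X \<longleftrightarrow>
     (\<forall>l\<in>lines X. l \<subseteq> points X \<and> finite l \<and> card l = q + 1) \<and>
     (\<forall>x\<in>points X. \<forall>y\<in>points X. x \<noteq> y \<longrightarrow> (\<exists>!l. l \<in> lines X \<and> x \<in> l \<and> y \<in> l)) \<and>
     (\<forall>l\<in>lines X. \<forall>m\<in>lines X. l \<noteq> m \<longrightarrow> (\<exists>!x. x \<in> l \<and> x \<in> m)) \<and>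
     (\<exists>Q\<subseteq>points X. card Q = 4 \<and> (\<forall>l\<in>lines X. card (Q \<inter> l) \<le> 2))"

definition affine_plane :: "nat \<Rightarrow> 'p plane \<Rightarrow> bool" where
  "affine_plane q X \<longleftrightarrow>
     (\<forall>l\<in>lines X. l \<subseteq> points X \<and> finite l \<and> card l = q) \<and>
     (\<forall>x\<in>points X. \<forall>y\<in>points X. x \<noteq> y \<longrightarrow> (\<exists>!l. l \<in> lines X \<and> x \<in> l \<and> y \<in> l)) \<and>
     (\<forall>l\<in>lines X. \<forall>x\<in>points X - l. \<exists>!m. m \<in> lines X \<and> x \<in> m \<and> l \<inter> m = {}) \<and>
     (\<exists>Q\<subseteq>points X. card Q = 3 \<and> (\<forall>l\<in>lines X. \<not> Q \<subseteq> l))"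

definition plane_isomorphic :: "'p plane \<Rightarrow> 'r plane \<Rightarrow> bool" where
  "plane_isomorphic X Y \<longleftrightarrow>
     (\<exists>f. bij_betw f (points X) (points Y) \<and> (\<lambda>l. f ` l) ` lines X = lines Y)"

text \<open>The planes \<open>PG(2,q)\<close> and \<open>AG(2,q)\<close>, where \<open>'f\<close> is the field with \<open>q\<close> elements: the points
  of the former are the one-dimensional subspaces of \<open>'f ^ 3\<close>, and each two-dimensional subspace
  gives a line, consisting of the one-dimensional subspaces it contains; the lines of the latter
  are the cosets of the one-dimensional subspaces of \<open>'f ^ 2\<close>.\<close>

definition PG2 :: "'f::{field,finite} itself \<Rightarrow> ('f ^ 3) set plane" where
  "PG2 _ =
     (let P = {U :: ('f ^ 3) set. vec.subspace U \<and> vec.dim U = 1}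
      in (P, {{U \<in> P. U \<subseteq> W} | W. vec.subspace W \<and> vec.dim W = 2}))"

definition AG2 :: "'f::{field,finite} itself \<Rightarrow> ('f ^ 2) plane" where
  "AG2 _ = (UNIV, {(\<lambda>u. a + u) ` U | a U. vec.subspace U \<and> vec.dim U = 1})"

text \<open>Up to isomorphism, \<open>PG(2,q)\<close> and \<open>AG(2,q)\<close> are the Desarguesian planes of order \<open>q\<close>.\<close>

definition desarguesian_projective_plane :: "'f::{field,finite} itself \<Rightarrow> 'p plane \<Rightarrow> bool" where
  "desarguesian_projective_plane F X \<longleftrightarrow>
     projective_plane CARD('f) X \<and> plane_isomorphic X (PG2 F)"

definition desarguesian_affine_plane :: "'f::{field,finite} itself \<Rightarrow> 'p plane \<Rightarrow> bool" where
  "desarguesian_affine_plane F X \<longleftrightarrow>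
     affine_plane CARD('f) X \<and> plane_isomorphic X (AG2 F)"

definition orthogoval :: "'p plane \<Rightarrow> 'p plane \<Rightarrow> bool" where
  "orthogoval X Y \<longleftrightarrow>
     (\<exists>q. projective_plane q X \<and> projective_plane q Y \<or> affine_plane q X \<and> affine_plane q Y) \<and>
     points X = points Y \<and>
     (\<forall>l\<in>lines X. \<forall>m\<in>lines Y. card (l \<inter> m) \<le> 2)"

abbreviation mutually_orthogoval :: "'p plane set \<Rightarrow> bool" where
  "mutually_orthogoval S \<equiv> pairwise orthogoval S"

text \<open>An array is a function of the row index \<open>i < n\<close> and the column index \<open>j < k\<close>; its values
  outside this range are irrelevant. Linear independence is that of the family of entries of row
  \<open>i\<close> indexed by the columns in \<open>T\<close>, so repeated entries count as dependent.\<close>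

definition CPHF ::
  "nat \<Rightarrow> nat \<Rightarrow> nat \<Rightarrow> nat \<Rightarrow> nat \<Rightarrow> (nat \<Rightarrow> nat \<Rightarrow> 'f::{field,finite} ^ 't::finite) \<Rightarrow> bool" where
  "CPHF lam n t k q A \<longleftrightarrow>
     t = CARD('t) \<and> q = CARD('f) \<and>
     (\<forall>i<n. \<forall>j<k. A i j \<noteq> 0) \<and>
     (\<forall>T\<subseteq>{..<k}. card T = t \<longrightarrow>
        lam \<le> card {i. i < n \<and> inj_on (A i) T \<and> vec.independent (A i ` T)})"

text \<open>Coordinates are numbered \<open>1, ..., t\<close>, as in \<^const>\<open>vector\<close>; in the numeral type \<open>'t\<close> with
  \<open>t\<close> elements, the last index is the image of the number \<open>t\<close> (which is also \<open>0\<close>).\<close>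

definition SCPHF ::
  "nat \<Rightarrow> nat \<Rightarrow> nat \<Rightarrow> nat \<Rightarrow> nat \<Rightarrow> (nat \<Rightarrow> nat \<Rightarrow> 'f::{field,finite} ^ 't::{finite,comm_ring_1}) \<Rightarrow> bool"
where
  "SCPHF lam n t k q A \<longleftrightarrow>
     CPHF lam n t k q A \<and> (\<forall>i<n. \<forall>j<k. A i j $ of_nat t \<noteq> 0)"

end

theory Submission
  imports Defs
begin

text \<open>Coordinatise every plane by vectors of \<open>'f ^ 3\<close>, so that three points of a plane whose
  coordinate vectors are dependent are collinear in it. Number the points; the rows of the array
  are then the coordinate vectors of the points in the individual planes. Three points that were
  collinear in two of the planes would lie on a line of each, contradicting orthogovality; so every
  three columns are independent in all rows but at most one.\<close>

section \<open>The array built from coordinatised orthogoval planes\<close>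

lemma orthogoval_card_Int_le:
  assumes "orthogoval X Y" "l \<in> lines X" "m \<in> lines Y"
  shows "finite (l \<inter> m)" "card (l \<inter> m) \<le> 2"
proof -
  \<comment> \<open>Finiteness comes from the plane axioms. It gives the bound on
    \<open>card\<close> its content, since \<open>card\<close> is 0 on infinite sets.\<close>
  have "finite l"
    using assms(1,2) by (auto simp: orthogoval_def projective_plane_def affine_plane_def)
  then show "finite (l \<inter> m)" by simp
  show "card (l \<inter> m) \<le> 2" using assms by (simp add: orthogoval_def)
qed

text \<open>The counting argument shared by the projective and the affine case: each plane X enters
  only through a map \<open>\<phi> X\<close> that sends noncollinear triples to independent ones.
  The second conclusion records where the entries come from, so that further properties of the
  coordinate vectors carry over to the array.\<close>

lemma CPHF_of_mutually_orthogoval: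
  fixes \<phi> :: "'p plane \<Rightarrow> 'p \<Rightarrow> 'f::{field,finite} ^ 't::finite"
  assumes S: "card S = s" "s \<ge> 1" and orth: "mutually_orthogoval S"
    and size: "\<And>X. X \<in> S \<Longrightarrow> finite (points X) \<and> k \<le> card (points X)"
    and nz: "\<And>X x. X \<in> S \<Longrightarrow> x \<in> points X \<Longrightarrow> \<phi> X x \<noteq> 0"
    and t: "CARD('t) = 3"
    and indep: "\<And>X T. X \<in> S \<Longrightarrow> T \<subseteq> points X \<Longrightarrow> card T = 3 \<Longrightarrow> \<forall>l\<in>lines X. \<not> T \<subseteq> l \<Longrightarrow>
      inj_on (\<phi> X) T \<and> vec.independent (\<phi> X ` T)"
  obtains A :: "nat \<Rightarrow> nat \<Rightarrow> 'f ^ 't"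
  where "CPHF (s - 1) s 3 k CARD('f) A"
    and "\<And>i j. i < s \<Longrightarrow> j < k \<Longrightarrow> \<exists>X\<in>S. \<exists>x\<in>points X. A i j = \<phi> X x"
proof -
  from S have fin: "finite S" and "S \<noteq> {}" by (auto intro: card_ge_0_finite)
  then obtain X0 where X0: "X0 \<in> S" by blast
  \<comment> \<open>\<open>pairwise\<close> speaks only of distinct planes; for
    \<open>X = X0\<close> the equality is trivial.\<close>
  have pts: "points X = points X0" if "X \<in> S" for X
    using pairwiseD[OF orth that X0] orthogoval_def by metis
  obtain h where h: "bij_betw h {..<s} S"
    using ex_bij_betw_nat_finite[OF fin] S by (auto simp: atLeast0LessThan)
  \<comment> \<open>The columns are labelled by k distinct common points, so a lower bound on the
    number of points is enough.\<close>
  obtain g where g: "g ` {..<k} \<subseteq> points X0" "inj_on g {..<k}"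
    using card_le_inj[of "{..<k}" "points X0"] size[OF X0] by auto
  have hS: "h i \<in> S" if "i < s" for i using h that by (auto simp: bij_betw_def)
  have gP: "g j \<in> points (h i)" if "i < s" "j < k" for i j
    using g(1) pts[OF hS] that by auto
  define A where "A i j = \<phi> (h i) (g j)" for i j
  have "s - 1 \<le> card {i. i < s \<and> inj_on (A i) T \<and> vec.independent (A i ` T)}"
    if T: "T \<subseteq> {..<k}" "card T = 3" for T
  proof -
    define good where "good = {i. i < s \<and> inj_on (A i) T \<and> vec.independent (A i ` T)}"
    \<comment> \<open>The bad rows. With at most one of them, at least s - 1 of the s rows are
      good.\<close>
    define B where "B = {..<s} - good"
    have injT: "inj_on g T" using g(2) T(1) inj_on_subset by blast
    then have cT: "card (g ` T) = 3" using T(2) by (simp add: card_image)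
    have line: "\<exists>l\<in>lines (h i). g ` T \<subseteq> l" if "i \<in> B" for i
    proof (rule ccontr)
      assume no: "\<not> ?thesis"
      have i: "i < s" "i \<notin> good" using that by (auto simp: B_def)
      have "g ` T \<subseteq> points (h i)" using gP i(1) T(1) by auto
      then have "inj_on (\<phi> (h i)) (g ` T) \<and> vec.independent (\<phi> (h i) ` g ` T)"
        using indep[OF hS[OF i(1)] _ cT] no by blast
      moreover have "A i = \<phi> (h i) \<circ> g" by (auto simp: A_def)
      ultimately have "inj_on (A i) T \<and> vec.independent (A i ` T)"
        using comp_inj_on[OF injT] by (metis image_comp)
      then show False using i by (simp add: good_def)
    qed
    have "i = j" if B: "i \<in> B" "j \<in> B" for i j
    proof (rule ccontr)
      assume "i \<noteq> j"
      have ij: "i < s" "j < s" using that by (auto simp: B_def)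
      \<comment> \<open>Distinct rows belong to distinct planes, which is what pairwise
        orthogovality requires.\<close>
      then have "h i \<noteq> h j" using h \<open>i \<noteq> j\<close> by (auto simp: bij_betw_def inj_on_def)
      then have orth_ij: "orthogoval (h i) (h j)" using orth hS ij by (simp add: pairwise_def)
      obtain l m where lm: "l \<in> lines (h i)" "m \<in> lines (h j)" "g ` T \<subseteq> l" "g ` T \<subseteq> m"
        using line[OF B(1)] line[OF B(2)] by blast
      have "card (g ` T) \<le> card (l \<inter> m)"
        using lm(3,4) by (intro card_mono orthogoval_card_Int_le(1)[OF orth_ij lm(1,2)]) simp
      also have "\<dots> \<le> 2" by (rule orthogoval_card_Int_le(2)[OF orth_ij lm(1,2)])
      finally have "card (g ` T) \<le> 2" .
      then show False using cT by simp
    qed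
    then have "card B \<le> 1" by (metis card_le_Suc0_iff_eq One_nat_def B_def finite_Diff finite_lessThan)
    moreover have "s - card good \<le> card B"
      using diff_card_le_card_Diff[of good "{..<s}"] by (simp add: B_def good_def)
    ultimately show ?thesis by (simp add: good_def)
  qed
  moreover have "A i j \<noteq> 0" if "i < s" "j < k" for i j
    using nz hS gP that by (simp add: A_def)
  ultimately have "CPHF (s - 1) s 3 k CARD('f) A" using t by (simp add: CPHF_def)
  then show thesis using that hS gP unfolding A_def by blast
qed

section \<open>Coordinate vectors for AG(2,q) and PG(2,q)\<close>

lemma subspace_dim_1_eq_span:
  fixes U :: "('f::field ^ 'n::finite) set"
  assumes "vec.subspace U" "vec.dim U = 1" "v \<in> U" "v \<noteq> 0"
  shows "U = vec.span {v}"
proof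
  have "vec.independent {v}" using assms(4) by simp
  then show "U \<subseteq> vec.span {v}"
    using assms(2,3) by (intro vec.card_ge_dim_independent) auto
  show "vec.span {v} \<subseteq> U" using assms(1,3) by (intro vec.span_minimal) auto
qed

lemma subspace_dim_1_nonzero:
  fixes U :: "('f::field ^ 'n::finite) set"
  assumes "vec.dim U = 1"
  obtains v where "v \<in> U" "v \<noteq> 0"
  using assms vec.dim_eq_0[of U] by (metis insertI1 subsetI singleton_iff zero_neq_one)

text \<open>The map embeds the affine plane as the vectors with last coordinate 1. If one such
  vector is a linear combination of two others, the last coordinate forces the coefficients to sum
  to 1. The combination is then affine, and its point lies on the line through the other
  two.\<close>

lemma AG2_independent:
  fixes \<phi> :: "'f::{field,finite} ^ 2 \<Rightarrow> 'f ^ 3"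
  defines "\<phi> \<equiv> \<lambda>x. vector [x $ 1, x $ 2, 1]"
  assumes T: "card T = 3" and no: "\<forall>l\<in>lines (AG2 TYPE('f)). \<not> T \<subseteq> l"
  shows "inj_on \<phi> T \<and> vec.independent (\<phi> ` T)"
proof -
  have inj: "inj \<phi>" by (auto simp: inj_def \<phi>_def vec_eq_iff forall_2 forall_3)
  obtain x y z where xyz: "T = {x, y, z}" "x \<noteq> y" "x \<noteq> z" "y \<noteq> z"
    using T by (auto simp: card_3_iff)
  have last: "\<phi> v $ 3 = 1" for v by (simp add: \<phi>_def)
  have nz: "\<phi> v \<noteq> 0" for v using last[of v] by auto
  have ny: "\<phi> y \<notin> vec.span {\<phi> x}"
  proof
    assume "\<phi> y \<in> vec.span {\<phi> x}"
    then obtain c where c: "\<phi> y = c *s \<phi> x" by (auto simp: vec.span_singleton)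
    then have "c = 1" using last[of x] last[of y] by simp
    then show False using c inj xyz by (simp add: inj_eq)
  qed
  have nzz: "\<phi> z \<notin> vec.span {\<phi> y, \<phi> x}"
  proof
    assume "\<phi> z \<in> vec.span {\<phi> y, \<phi> x}"
    then obtain b a where "\<phi> z - b *s \<phi> y = a *s \<phi> x"
      using vec.span_breakdown_eq[of "\<phi> z" "\<phi> y" "{\<phi> x}"] by (auto simp: vec.span_singleton)
    then have e: "\<phi> z $ i = a * \<phi> x $ i + b * \<phi> y $ i" for i
      by (metis diff_eq_eq vector_add_component vector_smult_component)
    \<comment> \<open>The third coordinate yields a + b = 1; the first two then place z on the line
      through x and y.\<close>
    have a: "a = 1 - b" using e[of 3] last by (simp add: algebra_simps)
    have "z = x + b *s (y - x)"
      using e[of 1] e[of 2] by (simp add: vec_eq_iff forall_2 \<phi>_def a algebra_simps)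
    \<comment> \<open>The points z, y and x have parameters b, 1 and 0 on the coset of the span of y
      - x through x.\<close>
    moreover have "y = x + 1 *s (y - x)" "x = x + 0 *s (y - x)" by simp_all
    ultimately have "T \<subseteq> (\<lambda>u. x + u) ` vec.span {y - x}"
      unfolding xyz vec.span_singleton by blast
    moreover have "vec.dim (vec.span {y - x}) = 1"
      using xyz by (simp add: vec.dim_eq_card_independent)
    then have "(\<lambda>u. x + u) ` vec.span {y - x} \<in> lines (AG2 TYPE('f))"
      unfolding AG2_def by fastforce
    ultimately show False using no by blast
  qed
  have "vec.independent {\<phi> z, \<phi> y, \<phi> x}"
    using nz ny nzz by (simp add: vec.independent_insert)
  moreover have "\<phi> ` T = {\<phi> z, \<phi> y, \<phi> x}" using xyz by auto
  ultimately show ?thesis using inj_on_subset[OF inj] by simp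
qed

text \<open>Any choice of nonzero representatives works. If the third representative lies in the
  span of two independent ones, that span is a two-dimensional subspace containing all three points,
  hence a line through them.\<close>

lemma PG2_independent:
  fixes \<phi> :: "('f::{field,finite} ^ 3) set \<Rightarrow> 'f ^ 3"
  assumes \<phi>: "\<And>U. U \<in> points (PG2 TYPE('f)) \<Longrightarrow> \<phi> U \<in> U \<and> \<phi> U \<noteq> 0"
  assumes T: "T \<subseteq> points (PG2 TYPE('f))" "card T = 3"
    and no: "\<forall>l\<in>lines (PG2 TYPE('f)). \<not> T \<subseteq> l"
  shows "inj_on \<phi> T \<and> vec.independent (\<phi> ` T)"
proof -
  \<comment> \<open>A point is recovered from its representative, so distinct points have
    nonproportional representatives.\<close>
  have span: "U = vec.span {\<phi> U}" if "U \<in> points (PG2 TYPE('f))" for U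
    using that \<phi>[OF that] subspace_dim_1_eq_span[of U "\<phi> U"] by (simp add: PG2_def)
  then have inj: "inj_on \<phi> T" using T(1) by (metis inj_onI subsetD)
  obtain x y z where xyz: "T = {x, y, z}" "x \<noteq> y" "x \<noteq> z" "y \<noteq> z"
    using T by (auto simp: card_3_iff)
  have P: "x \<in> points (PG2 TYPE('f))" "y \<in> points (PG2 TYPE('f))" "z \<in> points (PG2 TYPE('f))"
    using T xyz by auto
  have ny: "\<phi> y \<notin> vec.span {\<phi> x}"
  proof
    assume "\<phi> y \<in> vec.span {\<phi> x}"
    then have "\<phi> y \<in> x" using span[OF P(1)] by simp
    then have "x = vec.span {\<phi> y}"
      using P(1) \<phi>[OF P(2)] subspace_dim_1_eq_span[of x "\<phi> y"] by (simp add: PG2_def)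
    then show False using span[OF P(2)] xyz by simp
  qed
  then have ind: "vec.independent {\<phi> y, \<phi> x}" using \<phi> P by (simp add: vec.independent_insert)
  have nz: "\<phi> z \<notin> vec.span {\<phi> y, \<phi> x}"
  proof
    let ?W = "vec.span {\<phi> y, \<phi> x}"
    assume z: "\<phi> z \<in> ?W"
    have "vec.span {\<phi> v} \<subseteq> ?W" if "v \<in> T" for v
      using that z xyz by (intro vec.span_minimal) (auto intro: vec.span_base)
    then have "T \<subseteq> {U \<in> points (PG2 TYPE('f)). U \<subseteq> ?W}"
      using T(1) span by blast
    \<comment> \<open>The dimension is computed as the cardinality of the spanning set, so its two
      elements must differ.\<close>
    moreover have "\<phi> y \<noteq> \<phi> x" using ny vec.span_base by fastforce
    then have "vec.dim ?W = 2" using ind by (simp add: vec.dim_eq_card_independent)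
    then have "{U \<in> points (PG2 TYPE('f)). U \<subseteq> ?W} \<in> lines (PG2 TYPE('f))"
      unfolding PG2_def by (auto simp: Let_def)
    ultimately show False using no by blast
  qed
  have "vec.independent {\<phi> z, \<phi> y, \<phi> x}"
    using vec.independent_insertI[OF nz ind] .
  moreover have "\<phi> ` T = {\<phi> z, \<phi> y, \<phi> x}" using xyz by auto
  ultimately show ?thesis using inj by auto
qed

text \<open>The q^3 - 1 nonzero vectors are covered by the points, each of which contains at most q
  - 1 of them. Bounding the union by the sum avoids proving that the points meet only in 0.\<close>

lemma card_points_PG2_ge:
  "CARD('f)\<^sup>2 + CARD('f) + 1 \<le> card (points (PG2 TYPE('f::{field,finite})))"
proof -
  let ?q = "CARD('f)" and ?P = "points (PG2 TYPE('f))"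
  have q: "?q \<ge> 2"
    using card_mono[of "UNIV :: 'f set" "{0, 1}"] by simp
  have cU: "card (U - {0}) \<le> ?q - 1" if "U \<in> ?P" for U :: "('f ^ 3) set"
  proof -
    have U: "vec.subspace U" "vec.dim U = 1" using that by (auto simp: PG2_def)
    then obtain v where "v \<in> U" "v \<noteq> 0" using subspace_dim_1_nonzero by blast
    with U have "U = range (\<lambda>c. c *s v)"
      using subspace_dim_1_eq_span vec.span_singleton by metis
    then have "card U \<le> ?q" by (simp add: card_image_le)
    moreover have "0 \<in> U" using U(1) by (rule vec.subspace_0)
    ultimately show ?thesis by simp
  qed
  have "UNIV - {0 :: 'f ^ 3} \<subseteq> (\<Union>U\<in>?P. U - {0})"
  proof
    fix v :: "'f ^ 3" assume "v \<in> UNIV - {0}"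
    then have "vec.span {v} \<in> ?P" "v \<in> vec.span {v} - {0}"
      by (auto simp: PG2_def vec.dim_eq_card_independent intro: vec.span_base)
    then show "v \<in> (\<Union>U\<in>?P. U - {0})" by blast
  qed
  then have "card (UNIV - {0 :: 'f ^ 3}) \<le> card (\<Union>U\<in>?P. U - {0})" by (intro card_mono) auto
  also have "\<dots> \<le> (\<Sum>U\<in>?P. card (U - {0}))" by (intro card_UN_le) auto
  also have "\<dots> \<le> card ?P * (?q - 1)" using sum_bounded_above[of ?P, OF cU] by simp
  finally have "?q ^ 3 - 1 \<le> card ?P * (?q - 1)" by (simp add: CARD_vec)
  \<comment> \<open>Writing q as a successor removes the truncated subtraction from the
    factorisation of q^3 - 1.\<close>
  moreover obtain r where r: "?q = Suc r" using q by (cases ?q) auto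
  then have "?q ^ 3 - 1 = (?q\<^sup>2 + ?q + 1) * (?q - 1)"
    by (simp add: power2_eq_square power3_eq_cube algebra_simps)
  ultimately have "(?q\<^sup>2 + ?q + 1) * (?q - 1) \<le> card ?P * (?q - 1)" by metis
  then show ?thesis using q by (subst (asm) mult_le_cancel2) simp
qed

section \<open>Transport of coordinates along isomorphisms\<close>

lemma plane_isomorphic_coordinates:
  fixes \<phi> :: "'r \<Rightarrow> 'f::field ^ 't::finite"
  assumes iso: "plane_isomorphic X Y" and sub: "\<forall>l\<in>lines X. l \<subseteq> points X"
    and nz: "\<And>y. y \<in> points Y \<Longrightarrow> \<phi> y \<noteq> 0 \<and> Q (\<phi> y)"
    and indep: "\<And>T. T \<subseteq> points Y \<Longrightarrow> card T = 3 \<Longrightarrow> \<forall>l\<in>lines Y. \<not> T \<subseteq> l \<Longrightarrow>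
      inj_on \<phi> T \<and> vec.independent (\<phi> ` T)"
  shows "\<exists>\<psi>. (\<forall>x\<in>points X. \<psi> x \<noteq> 0 \<and> Q (\<psi> x)) \<and>
    (\<forall>T\<subseteq>points X. card T = 3 \<longrightarrow> (\<forall>l\<in>lines X. \<not> T \<subseteq> l) \<longrightarrow>
      inj_on \<psi> T \<and> vec.independent (\<psi> ` T))"
proof -
  from iso obtain f where f: "bij_betw f (points X) (points Y)"
    and L: "(\<lambda>l. f ` l) ` lines X = lines Y"
    unfolding plane_isomorphic_def by blast
  have inj: "inj_on f (points X)" using f by (simp add: bij_betw_def)
  have "inj_on (\<phi> \<circ> f) T \<and> vec.independent ((\<phi> \<circ> f) ` T)"
    if T: "T \<subseteq> points X" "card T = 3" and no: "\<forall>l\<in>lines X. \<not> T \<subseteq> l" for T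
  proof -
    have injT: "inj_on f T" using inj T(1) inj_on_subset by blast
    have "\<not> f ` T \<subseteq> m" if m: "m \<in> lines Y" for m
    proof
      assume "f ` T \<subseteq> m"
      moreover obtain l where l: "l \<in> lines X" "m = f ` l" using m L by blast
      \<comment> \<open>Collinearity pulls back because f is injective on the points and l consists
        of points.\<close>
      ultimately have "T \<subseteq> l" using inj_on_image_subset_iff[OF inj T(1)] sub by blast
      then show False using no l by blast
    qed
    moreover have "f ` T \<subseteq> points Y" using f T(1) by (auto simp: bij_betw_def)
    moreover have "card (f ` T) = 3" using injT T(2) by (simp add: card_image)
    ultimately have "inj_on \<phi> (f ` T) \<and> vec.independent (\<phi> ` f ` T)" using indep by blast
    then show ?thesis using comp_inj_on[OF injT] by (metis image_comp)
  qed
  moreover have "(\<phi> \<circ> f) x \<noteq> 0 \<and> Q ((\<phi> \<circ> f) x)" if "x \<in> points X" for x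
    using nz f that by (auto simp: bij_betw_def)
  ultimately show "\<exists>\<psi>. (\<forall>x\<in>points X. \<psi> x \<noteq> 0 \<and> Q (\<psi> x)) \<and>
    (\<forall>T\<subseteq>points X. card T = 3 \<longrightarrow> (\<forall>l\<in>lines X. \<not> T \<subseteq> l) \<longrightarrow>
      inj_on \<psi> T \<and> vec.independent (\<psi> ` T))" by blast
qed

text \<open>All planes are isomorphic to one model Y, so a single map \<phi> on Y coordinatises each
  of them through its own isomorphism. The predicate \<open>Q\<close> carries the condition on
  entries: trivial in the projective case, nonzero last coordinate in the affine case.\<close>

lemma CPHF_of_isomorphic_planes:
  fixes \<phi> :: "'r \<Rightarrow> 'f::{field,finite} ^ 3" and S :: "'p plane set"
  assumes S: "card S = s" "s \<ge> 1" "mutually_orthogoval S"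
    and iso: "\<And>X. X \<in> S \<Longrightarrow> plane_isomorphic X Y \<and> (\<forall>l\<in>lines X. l \<subseteq> points X)"
    and Y: "finite (points Y)" "k \<le> card (points Y)"
    and nz: "\<And>y. y \<in> points Y \<Longrightarrow> \<phi> y \<noteq> 0 \<and> Q (\<phi> y)"
    and indep: "\<And>T. T \<subseteq> points Y \<Longrightarrow> card T = 3 \<Longrightarrow> \<forall>l\<in>lines Y. \<not> T \<subseteq> l \<Longrightarrow>
      inj_on \<phi> T \<and> vec.independent (\<phi> ` T)"
  obtains A :: "nat \<Rightarrow> nat \<Rightarrow> 'f ^ 3"
  where "CPHF (s - 1) s 3 k CARD('f) A" "\<And>i j. i < s \<Longrightarrow> j < k \<Longrightarrow> Q (A i j)"
proof -
  have "\<forall>X\<in>S. \<exists>\<psi>. (\<forall>x\<in>points X. \<psi> x \<noteq> 0 \<and> Q (\<psi> x)) \<and>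
    (\<forall>T\<subseteq>points X. card T = 3 \<longrightarrow> (\<forall>l\<in>lines X. \<not> T \<subseteq> l) \<longrightarrow>
      inj_on \<psi> T \<and> vec.independent (\<psi> ` T))"
  proof
    fix X assume "X \<in> S"
    note iso_X = iso[OF this, THEN conjunct1] iso[OF this, THEN conjunct2]
    show "\<exists>\<psi>. (\<forall>x\<in>points X. \<psi> x \<noteq> 0 \<and> Q (\<psi> x)) \<and>
      (\<forall>T\<subseteq>points X. card T = 3 \<longrightarrow> (\<forall>l\<in>lines X. \<not> T \<subseteq> l) \<longrightarrow>
        inj_on \<psi> T \<and> vec.independent (\<psi> ` T))"
      by (rule plane_isomorphic_coordinates[where \<phi> = \<phi> and Q = Q, OF iso_X nz indep])
  qed
  then obtain \<psi> :: "'p plane \<Rightarrow> 'p \<Rightarrow> 'f ^ 3"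
    where \<psi>: "\<And>X x. X \<in> S \<Longrightarrow> x \<in> points X \<Longrightarrow> \<psi> X x \<noteq> 0 \<and> Q (\<psi> X x)"
      "\<And>X T. X \<in> S \<Longrightarrow> T \<subseteq> points X \<Longrightarrow> card T = 3 \<Longrightarrow> \<forall>l\<in>lines X. \<not> T \<subseteq> l \<Longrightarrow>
        inj_on (\<psi> X) T \<and> vec.independent (\<psi> X ` T)"
    by metis
  have size: "finite (points X) \<and> k \<le> card (points X)" if "X \<in> S" for X
    using iso[OF that] Y unfolding plane_isomorphic_def
    by (metis bij_betw_finite bij_betw_same_card)
  obtain A :: "nat \<Rightarrow> nat \<Rightarrow> 'f ^ 3" where A: "CPHF (s - 1) s 3 k CARD('f) A"
    "\<And>i j. i < s \<Longrightarrow> j < k \<Longrightarrow> \<exists>X\<in>S. \<exists>x\<in>points X. A i j = \<psi> X x"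
    using CPHF_of_mutually_orthogoval[where \<phi> = \<psi>, OF S size] \<psi> by auto
  show thesis using that[OF A(1)] A(2) \<psi>(1) by metis
qed

theorem theorem4p4:
  fixes q s :: nat
  assumes "primepow q" and "CARD('f::{field,finite}) = q" and "s \<ge> 1"
  shows "((\<exists>S :: 'p plane set. card S = s \<and> mutually_orthogoval S \<and>
             (\<forall>X\<in>S. desarguesian_projective_plane TYPE('f) X)) \<longrightarrow>
          (\<exists>A :: nat \<Rightarrow> nat \<Rightarrow> 'f ^ 3. CPHF (s - 1) s 3 (q\<^sup>2 + q + 1) q A)) \<and>
         ((\<exists>S :: 'r plane set. card S = s \<and> mutually_orthogoval S \<and>
             (\<forall>X\<in>S. desarguesian_affine_plane TYPE('f) X)) \<longrightarrow>
          (\<exists>A :: nat \<Rightarrow> nat \<Rightarrow> 'f ^ 3. SCPHF (s - 1) s 3 (q\<^sup>2) q A))"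
proof (intro conjI impI; elim exE conjE)
  fix S :: "'p plane set"
  assume S: "card S = s" "mutually_orthogoval S"
    and des: "\<forall>X\<in>S. desarguesian_projective_plane TYPE('f) X"
  \<comment> \<open>Homogeneous coordinates: an arbitrary nonzero vector of each one-dimensional
    subspace.\<close>
  define \<phi> :: "('f ^ 3) set \<Rightarrow> 'f ^ 3" where "\<phi> U = (SOME v. v \<in> U \<and> v \<noteq> 0)" for U
  have \<phi>: "\<phi> U \<in> U \<and> \<phi> U \<noteq> 0" if "U \<in> points (PG2 TYPE('f))" for U
  proof -
    have "\<exists>v. v \<in> U \<and> v \<noteq> 0"
      using that subspace_dim_1_nonzero[of U] by (auto simp: PG2_def)
    then show ?thesis unfolding \<phi>_def by (rule someI_ex)
  qed
  have iso: "plane_isomorphic X (PG2 TYPE('f)) \<and> (\<forall>l\<in>lines X. l \<subseteq> points X)" if "X \<in> S" for X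
    using des that by (simp add: desarguesian_projective_plane_def projective_plane_def)
  show "\<exists>A :: nat \<Rightarrow> nat \<Rightarrow> 'f ^ 3. CPHF (s - 1) s 3 (q\<^sup>2 + q + 1) q A"
  proof (rule CPHF_of_isomorphic_planes[where \<phi> = \<phi> and Q = "\<lambda>_. True",
        OF S(1) assms(3) S(2) iso finite card_points_PG2_ge])
    show "inj_on \<phi> T \<and> vec.independent (\<phi> ` T)"
      if "T \<subseteq> points (PG2 TYPE('f))" "card T = 3" "\<forall>l\<in>lines (PG2 TYPE('f)). \<not> T \<subseteq> l" for T
      using PG2_independent[of \<phi>] \<phi> that by simp
  qed (use \<phi> assms(2) in auto)
next
  fix S :: "'r plane set"
  assume S: "card S = s" "mutually_orthogoval S"
    and des: "\<forall>X\<in>S. desarguesian_affine_plane TYPE('f) X"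
  have iso: "plane_isomorphic X (AG2 TYPE('f)) \<and> (\<forall>l\<in>lines X. l \<subseteq> points X)" if "X \<in> S" for X
    using des that by (simp add: desarguesian_affine_plane_def affine_plane_def)
  let ?\<phi> = "\<lambda>x :: 'f ^ 2. vector [x $ 1, x $ 2, 1] :: 'f ^ 3"
  have last: "?\<phi> x $ 3 = 1" for x by simp
  have nz: "?\<phi> x \<noteq> 0 \<and> ?\<phi> x $ 3 \<noteq> 0" for x
    using last[of x] by (metis zero_index zero_neq_one)
  have "q\<^sup>2 \<le> card (points (AG2 TYPE('f)))"
    using assms(2) by (simp add: AG2_def CARD_vec)
  then obtain A :: "nat \<Rightarrow> nat \<Rightarrow> 'f ^ 3"
    where A: "CPHF (s - 1) s 3 (q\<^sup>2) CARD('f) A" "\<And>i j. i < s \<Longrightarrow> j < q\<^sup>2 \<Longrightarrow> A i j $ 3 \<noteq> 0"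
    using CPHF_of_isomorphic_planes[where \<phi> = ?\<phi> and Q = "\<lambda>v. v $ 3 \<noteq> 0" and k = "q\<^sup>2",
        OF S(1) assms(3) S(2) iso finite _ nz AG2_independent] by metis
  \<comment> \<open>The index \<open>of_nat 3\<close> of the Sherwood condition is the numeral
    \<open>3\<close>, the coordinate that the embedding sets to 1.\<close>
  then have "SCPHF (s - 1) s 3 (q\<^sup>2) q A" using assms(2) by (simp add: SCPHF_def)
  then show "\<exists>A :: nat \<Rightarrow> nat \<Rightarrow> 'f ^ 3. SCPHF (s - 1) s 3 (q\<^sup>2) q A" by blast
qed

end
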